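(* Assume CH. For each p-point $D$ on $\omega$ there is a p-point $E$ such that $E>_{RK}D$ and moreover $E>_T D$.
   Context: For ultrafilters on $\omega$, $E\ge_{RK}D$ means there is $h:\omega\to\omega$ with $D=\{X:h^{-1}(X)\in E\}$; $E>_{RK}D$ means $E\ge_{RK}D$ and not $D\ge_{RK}E$. $E\ge_T D$ means there is a map $E\to D$ sending cofinal subsets of $(E,\supseteq)$ to cofinal subsets of $(D,\supseteq)$; $E>_T D$ means $E\ge_T D$ and not $D\ge_T E$. A p-point is a nonprincipal ultrafilter on $\omega$ in which every countable subfamily $\{X_n\}$ has some $X$ in the ultrafilter with $X\setminus X_n$ finite for all $n$. *)

theory Defs
  imports Complex_Main "HOL-Library.Countable_Set"
begin

unbundle cardinal_syntax

text \<open>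
  An ultrafilter is represented as the family of its members, because it also has to serve as
  the carrier of a partial order under reverse inclusion.
\<close>

definition is_ultrafilter :: "'a set set \<Rightarrow> bool" where
  "is_ultrafilter U \<longleftrightarrow>
     UNIV \<in> U \<and> {} \<notin> U \<and>
     (\<forall>X\<in>U. \<forall>Y\<in>U. X \<inter> Y \<in> U) \<and>
     (\<forall>X\<in>U. \<forall>Y. X \<subseteq> Y \<longrightarrow> Y \<in> U) \<and>
     (\<forall>X. X \<in> U \<or> - X \<in> U)"

lemma is_ultrafilter_iff_filter:
  "is_ultrafilter U \<longleftrightarrow>
     (\<exists>F. F \<noteq> bot \<and> (\<forall>P. eventually P F \<or> eventually (\<lambda>x. \<not> P x) F) \<and>
          U = {X. eventually (\<lambda>x. x \<in> X) F})"
proof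
  assume U: "is_ultrafilter U"
  define F where "F = Abs_filter (\<lambda>P. Collect P \<in> U)"
  have "is_filter (\<lambda>P. Collect P \<in> U)"
  proof
    show "{x. True} \<in> U"
      using U by (simp add: is_ultrafilter_def)
    show "{x. P x \<and> Q x} \<in> U" if "Collect P \<in> U" "Collect Q \<in> U" for P Q
      using U that unfolding is_ultrafilter_def Collect_conj_eq by blast
    show "Collect Q \<in> U" if "\<forall>x. P x \<longrightarrow> Q x" "Collect P \<in> U" for P Q
      using U that unfolding is_ultrafilter_def by (metis Collect_mono)
  qed
  then have ev: "eventually P F \<longleftrightarrow> Collect P \<in> U" for P
    unfolding F_def by (rule eventually_Abs_filter)
  have "F \<noteq> bot"
    using U by (auto simp: trivial_limit_def ev is_ultrafilter_def)
  moreover have "eventually P F \<or> eventually (\<lambda>x. \<not> P x) F" for P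
    using U unfolding ev is_ultrafilter_def Collect_neg_eq by blast
  moreover have "U = {X. eventually (\<lambda>x. x \<in> X) F}"
    by (simp add: ev)
  ultimately show "\<exists>F. F \<noteq> bot \<and> (\<forall>P. eventually P F \<or> eventually (\<lambda>x. \<not> P x) F) \<and>
      U = {X. eventually (\<lambda>x. x \<in> X) F}"
    by blast
next
  assume "\<exists>F. F \<noteq> bot \<and> (\<forall>P. eventually P F \<or> eventually (\<lambda>x. \<not> P x) F) \<and>
      U = {X. eventually (\<lambda>x. x \<in> X) F}"
  then obtain F where "F \<noteq> bot" "\<forall>P. eventually P F \<or> eventually (\<lambda>x. \<not> P x) F"
    "U = {X. eventually (\<lambda>x. x \<in> X) F}"
    by blast
  then show "is_ultrafilter U"
    unfolding is_ultrafilter_def trivial_limit_def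
    by (auto intro: eventually_conj elim: eventually_mono)
qed

definition nonprincipal :: "'a set set \<Rightarrow> bool" where
  "nonprincipal U \<longleftrightarrow> \<not> (\<exists>a. U = {X. a \<in> X})"

definition p_point :: "nat set set \<Rightarrow> bool" where
  "p_point D \<longleftrightarrow> is_ultrafilter D \<and> nonprincipal D \<and>
     (\<forall>\<C>. \<C> \<subseteq> D \<and> countable \<C> \<longrightarrow> (\<exists>X\<in>D. \<forall>Y\<in>\<C>. finite (X - Y)))"

definition RK_ge :: "nat set set \<Rightarrow> nat set set \<Rightarrow> bool" (infix \<open>\<ge>\<^sub>R\<^sub>K\<close> 50) where
  "E \<ge>\<^sub>R\<^sub>K D \<longleftrightarrow> (\<exists>h :: nat \<Rightarrow> nat. D = {X. h -` X \<in> E})"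

definition RK_gt :: "nat set set \<Rightarrow> nat set set \<Rightarrow> bool" (infix \<open>>\<^sub>R\<^sub>K\<close> 50) where
  "E >\<^sub>R\<^sub>K D \<longleftrightarrow> E \<ge>\<^sub>R\<^sub>K D \<and> \<not> D \<ge>\<^sub>R\<^sub>K E"

text \<open>
  Cofinality in the directed order of reverse inclusion, where larger means smaller as a set.
  The constant \<^const>\<open>cofinal\<close> of the cardinals library demands a strict bound, so it is
  not the notion needed here.
\<close>

definition cofinal_subset :: "'a set set \<Rightarrow> 'a set set \<Rightarrow> bool" where
  "cofinal_subset D \<X> \<longleftrightarrow> \<X> \<subseteq> D \<and> (\<forall>A\<in>D. \<exists>B\<in>\<X>. A \<supseteq> B)"

definition Tukey_ge :: "nat set set \<Rightarrow> nat set set \<Rightarrow> bool" (infix \<open>\<ge>\<^sub>T\<close> 50) where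
  "E \<ge>\<^sub>T D \<longleftrightarrow>
     (\<exists>f. f ` E \<subseteq> D \<and> (\<forall>\<X>. cofinal_subset E \<X> \<longrightarrow> cofinal_subset D (f ` \<X>)))"

definition Tukey_gt :: "nat set set \<Rightarrow> nat set set \<Rightarrow> bool" (infix \<open>>\<^sub>T\<close> 50) where
  "E >\<^sub>T D \<longleftrightarrow> E \<ge>\<^sub>T D \<and> \<not> D \<ge>\<^sub>T E"

definition CH :: bool where
  "CH \<longleftrightarrow> |UNIV :: nat set set| =o cardSuc natLeq"

end

theory Submission
  imports Defs "HOL-Library.Nat_Bijection" "HOL-Library.Countable_Set_Type"
begin

text \<open>
  On a p-point \<open>D\<close>, a monotone map into another family is, below some member of \<open>D\<close>,
  determined by finite approximations of its argument, so the ultrafilters Tukey below \<open>D\<close>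
  are coded by subsets of \<open>\<omega>\<close>. Fix \<open>h\<close> with finite fibres of growing size and call
  a set large if, along \<open>D\<close>, its traces on the fibres of \<open>h\<close> have unbounded cardinality.
  Large sets can be split, decided and diagonalised; under CH a tower of large sets of length
  \<open>\<omega>\<^sub>1\<close> generates a p-point projecting to \<open>D\<close>, and at each stage one of the two halves of a
  split large set is chosen to avoid the coded ultrafilter with that index.
\<close>

section \<open>Ultrafilters and the two orders\<close>

lemma ultrafilter_UNIV: "is_ultrafilter U \<Longrightarrow> UNIV \<in> U"
  by (simp add: is_ultrafilter_def)

lemma ultrafilter_Int: "is_ultrafilter U \<Longrightarrow> X \<in> U \<Longrightarrow> Y \<in> U \<Longrightarrow> X \<inter> Y \<in> U"
  by (simp add: is_ultrafilter_def)

lemma ultrafilter_mono: "is_ultrafilter U \<Longrightarrow> X \<in> U \<Longrightarrow> X \<subseteq> Y \<Longrightarrow> Y \<in> U"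
  unfolding is_ultrafilter_def by blast

lemma ultrafilter_Compl_iff: "is_ultrafilter U \<Longrightarrow> - X \<in> U \<longleftrightarrow> X \<notin> U"
  unfolding is_ultrafilter_def by (metis Compl_disjoint)

lemma ultrafilter_disjoint:
  "is_ultrafilter U \<Longrightarrow> X \<inter> Y = {} \<Longrightarrow> X \<in> U \<Longrightarrow> Y \<notin> U"
  unfolding is_ultrafilter_def by metis

lemma ultrafilter_Inter:
  assumes "is_ultrafilter U" "finite \<F>" "\<F> \<subseteq> U"
  shows "\<Inter>\<F> \<in> U"
  using assms(2,3)
  by (induction) (use assms(1) ultrafilter_UNIV ultrafilter_Int in auto)

lemma nonprincipal_not_finite:
  assumes "is_ultrafilter U" "nonprincipal U" "finite X"
  shows "X \<notin> U"
proof
  assume "X \<in> U"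
  have "- {a} \<in> U" for a
  proof (rule ccontr)
    assume "- {a} \<notin> U"
    then have "{a} \<in> U"
      using assms(1) ultrafilter_Compl_iff by blast
    then have "U = {X. a \<in> X}"
      using assms(1) ultrafilter_mono[of U "{a}"] ultrafilter_disjoint[of U "{a}"] by blast
    then show False
      using assms(2) by (auto simp: nonprincipal_def)
  qed
  then have "(\<Inter>a\<in>X. - {a}) \<in> U"
    using assms(1,3) by (intro ultrafilter_Inter) auto
  moreover have "(\<Inter>a\<in>X. - {a}) \<inter> X = {}"
    by auto
  ultimately show False
    using \<open>X \<in> U\<close> assms(1) ultrafilter_disjoint by blast
qed

text \<open>Direct image under \<open>h\<close> is a Tukey map: a set inside the preimage of
  \<open>A\<close> has its image inside \<open>A\<close>, so cofinal families go to cofinal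
  families.\<close>

lemma RK_ge_imp_Tukey_ge:
  assumes "is_ultrafilter E" "E \<ge>\<^sub>R\<^sub>K D"
  shows "E \<ge>\<^sub>T D"
proof -
  obtain h where h: "D = {X. h -` X \<in> E}"
    using assms(2) by (auto simp: RK_ge_def)
  have "h ` X \<in> D" if "X \<in> E" for X
    using ultrafilter_mono[OF assms(1) that, of "h -` h ` X"] by (auto simp: h)
  then have "image h ` E \<subseteq> D"
    by blast
  moreover have "cofinal_subset D (image h ` \<X>)" if "cofinal_subset E \<X>" for \<X>
    unfolding cofinal_subset_def
  proof (intro conjI ballI)
    show "image h ` \<X> \<subseteq> D"
      using that \<open>image h ` E \<subseteq> D\<close> by (auto simp: cofinal_subset_def)
    show "\<exists>B\<in>image h ` \<X>. B \<subseteq> A" if "A \<in> D" for A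
    proof -
      have "h -` A \<in> E"
        using that by (simp add: h)
      then obtain B where "B \<in> \<X>" "B \<subseteq> h -` A"
        using \<open>cofinal_subset E \<X>\<close> by (auto simp: cofinal_subset_def)
      then show ?thesis
        by (intro bexI[of _ "h ` B"]) auto
    qed
  qed
  ultimately show ?thesis
    by (auto simp: Tukey_ge_def)
qed

section \<open>Ultrafilters Tukey below a p-point\<close>

text \<open>Replaces a Tukey map by a monotone one with cofinal values, the form to which the
  continuity argument applies.\<close>

lemma Tukey_ge_monotone:
  assumes "D \<ge>\<^sub>T E" "is_ultrafilter E"
  obtains F where "F ` D \<subseteq> E"
    and "\<And>X Y. X \<in> D \<Longrightarrow> X \<subseteq> Y \<Longrightarrow> F X \<subseteq> F Y"
    and "\<And>Z. Z \<in> E \<Longrightarrow> \<exists>X\<in>D. F X \<subseteq> Z"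
proof -
  obtain f where f: "f ` D \<subseteq> E"
    and cof: "\<And>\<X>. cofinal_subset D \<X> \<Longrightarrow> cofinal_subset E (f ` \<X>)"
    using assms(1) by (auto simp: Tukey_ge_def)
  define F where "F = (\<lambda>X. \<Union>(f ` {Y\<in>D. Y \<subseteq> X}))"
  show thesis
  proof (rule that[of F])
    have "F X \<in> E" if "X \<in> D" for X
    proof (rule ultrafilter_mono[OF assms(2)])
      show "f X \<in> E" using f that by auto
      show "f X \<subseteq> F X" using that by (auto simp: F_def)
    qed
    then show "F ` D \<subseteq> E" by blast
    show "F X \<subseteq> F Y" if "X \<subseteq> Y" for X Y
      using that by (auto simp: F_def)
    show "\<exists>X\<in>D. F X \<subseteq> Z" if "Z \<in> E" for Z
    proof (rule ccontr)
      assume no: "\<not> (\<exists>X\<in>D. F X \<subseteq> Z)"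
      \<comment> \<open>If no value of \<open>F\<close> fits inside \<open>Z\<close>, every member
        of \<open>D\<close> contains another one whose \<open>f\<close>-value escapes
        \<open>Z\<close>. These members are cofinal, yet none of their values lies inside
        \<open>Z\<close>.\<close>
      have "cofinal_subset D {Y\<in>D. \<not> f Y \<subseteq> Z}"
        unfolding cofinal_subset_def
      proof (intro conjI ballI)
        show "\<exists>B\<in>{Y\<in>D. \<not> f Y \<subseteq> Z}. B \<subseteq> X" if "X \<in> D" for X
        proof -
          have "\<not> F X \<subseteq> Z"
            using no that by blast
          then obtain Y where "Y \<in> D" "Y \<subseteq> X" "\<not> f Y \<subseteq> Z"
            unfolding F_def by blast
          then show ?thesis
            by (intro bexI[of _ Y]) simp_all
        qed
      qed auto
      then have "cofinal_subset E (f ` {Y\<in>D. \<not> f Y \<subseteq> Z})"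
        by (rule cof)
      then show False
        using that by (auto simp: cofinal_subset_def)
    qed
  qed
qed

section \<open>Continuity of monotone maps on a p-point\<close>

text \<open>A pseudo-intersection is inside \<open>W m\<close> only beyond some larger bound.
  Discarding every other block of a fast interval partition creates gaps, and at a cut
  \<open>m\<close> just before a gap the two bounds agree.\<close>

lemma p_point_infinitely_often_subset:
  fixes W :: "nat \<Rightarrow> nat set"
  assumes "p_point D" "\<And>m. W m \<in> D"
  obtains X where "X \<in> D" "\<And>j. \<exists>m>j. X - {..<m} \<subseteq> W m"
proof -
  have U: "is_ultrafilter D"
    using assms(1) by (simp add: p_point_def)
  obtain X0 where X0: "X0 \<in> D" "\<And>m. finite (X0 - W m)"
  proof -
    have "range W \<subseteq> D \<and> countable (range W)"
      using assms(2) by auto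
    then show thesis
      using assms(1) that unfolding p_point_def by (metis rangeI)
  qed
  have "\<exists>k. n < k \<and> X0 - {..<k} \<subseteq> W n" for n
  proof -
    obtain k where "X0 - W n \<subseteq> {..<k}"
      using X0(2)[of n] finite_nat_iff_bounded by blast
    then have "X0 - {..<max k (Suc n)} \<subseteq> W n"
      by auto
    then show ?thesis
      by (metis less_Suc_eq max.strict_coboundedI2 lessI)
  qed
  then obtain s where s: "\<And>n. n < s n" "\<And>n. X0 - {..<s n} \<subseteq> W n"
    by metis
  define g where "g i = (s ^^ i) 0" for i
  have g_Suc: "g (Suc i) = s (g i)" for i
    by (simp add: g_def)
  have "strict_mono g"
    by (simp add: strict_mono_Suc_iff g_Suc s(1))
  define idx where "idx x = (LEAST i. x < g i)" for x
  have idx: "idx x = Suc i" if "g i \<le> x" "x < g (Suc i)" for x i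
    unfolding idx_def
  proof (rule Least_equality)
    show "x < g (Suc i)" by fact
    show "Suc i \<le> j" if "x < g j" for j
      using \<open>g i \<le> x\<close> that strict_mono_less[OF \<open>strict_mono g\<close>, of i j] by auto
  qed
  note result = that
  \<comment> \<open>\<open>P\<close> is the parity of the blocks that are kept. When block
    \<open>Suc i\<close> is discarded, what remains beyond \<open>g i\<close> lies beyond
    \<open>s (g i)\<close>, hence inside \<open>W (g i)\<close>.\<close>
  have main: thesis if P: "{x. P (idx x)} \<in> D" and inf: "\<And>j. \<exists>i>j. \<not> P (Suc i)" for P
  proof (rule result)
    show "X0 \<inter> {x. P (idx x)} \<in> D"
      using U X0(1) P by (rule ultrafilter_Int)
    fix j
    obtain i where i: "j < i" "\<not> P (Suc i)"
      using inf by blast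
    have "X0 \<inter> {x. P (idx x)} - {..<g i} \<subseteq> X0 - {..<s (g i)}"
      using i idx[of i] by (auto simp: g_Suc not_less)
    then have "X0 \<inter> {x. P (idx x)} - {..<g i} \<subseteq> W (g i)"
      using s(2) by blast
    moreover have "j < g i"
      using i(1) strict_mono_imp_increasing[OF \<open>strict_mono g\<close>, of i] by linarith
    ultimately show "\<exists>m>j. X0 \<inter> {x. P (idx x)} - {..<m} \<subseteq> W m"
      by blast
  qed
  have "{x. even (idx x)} \<in> D \<or> {x. odd (idx x)} \<in> D"
    using ultrafilter_Compl_iff[OF U, of "{x. even (idx x)}"] by (auto simp: Collect_neg_eq)
  then show thesis
  proof
    assume *: "{x. even (idx x)} \<in> D"
    show thesis
    proof (rule main[OF *])
      show "\<exists>i>j. odd (Suc i)" for j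
        by (rule exI[of _ "2 * Suc j"]) auto
    qed
  next
    assume *: "{x. odd (idx x)} \<in> D"
    show thesis
    proof (rule main[OF *])
      show "\<exists>i>j. \<not> odd (Suc i)" for j
        by (rule exI[of _ "Suc (2 * j)"]) auto
    qed
  qed
qed

text \<open>For a cut \<open>m\<close> only finitely many initial segments and values
  \<open>j < m\<close> matter. Intersecting one counterexample for each failing pair gives a set
  \<open>W m\<close> beyond which monotonicity forbids any disagreement.
  \<open>p_point_infinitely_often_subset\<close> then supplies arbitrarily late good cuts on a
  single \<open>X\<close>.\<close>

lemma p_point_monotone_continuous:
  fixes F :: "nat set \<Rightarrow> nat set"
  assumes "p_point D" and mono: "\<And>X Y. X \<in> D \<Longrightarrow> X \<subseteq> Y \<Longrightarrow> F X \<subseteq> F Y"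
  obtains X where "X \<in> D"
    and "\<And>Y. Y \<in> D \<Longrightarrow> Y \<subseteq> X \<Longrightarrow>
           F Y = {j. \<exists>m. \<forall>Z\<in>D. Z \<inter> {..<m} = Y \<inter> {..<m} \<longrightarrow> j \<in> F Z}"
proof -
  have U: "is_ultrafilter D"
    using assms(1) by (simp add: p_point_def)
  define decides where "decides m W \<longleftrightarrow> (\<forall>Y\<in>D. \<forall>Z\<in>D. \<forall>j<m.
      Y - {..<m} \<subseteq> W \<and> Z \<inter> {..<m} = Y \<inter> {..<m} \<and> j \<in> F Y \<longrightarrow> j \<in> F Z)" for m W
  have "\<exists>W. W \<in> D \<and> decides m W" for m
  proof -
    \<comment> \<open>A pair of a segment and a value is bad if some member of \<open>D\<close> with
      that segment omits the value; \<open>c\<close> picks such a member.\<close>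
    define bad where "bad = {(s, j) \<in> Pow {..<m} \<times> {..<m}. \<exists>Z\<in>D. Z \<inter> {..<m} = s \<and> j \<notin> F Z}"
    have "\<exists>c. \<forall>p\<in>bad. c p \<in> D \<and> c p \<inter> {..<m} = fst p \<and> snd p \<notin> F (c p)"
      by (intro bchoice) (auto simp: bad_def)
    then obtain c where c: "\<forall>p\<in>bad. c p \<in> D \<and> c p \<inter> {..<m} = fst p \<and> snd p \<notin> F (c p)" ..
    have "finite bad"
      by (rule finite_subset[of _ "Pow {..<m} \<times> {..<m}"]) (auto simp: bad_def)
    then have "\<Inter>(c ` bad) \<in> D"
      using c by (intro ultrafilter_Inter[OF U]) auto
    have "j \<in> F Z"
      if YZ: "Y \<in> D" "Z \<in> D" "j < m" "Y - {..<m} \<subseteq> \<Inter>(c ` bad)"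
        "Z \<inter> {..<m} = Y \<inter> {..<m}" "j \<in> F Y" for Y Z j
    proof (rule ccontr)
      assume "j \<notin> F Z"
      then have b: "(Y \<inter> {..<m}, j) \<in> bad"
        using YZ by (auto simp: bad_def)
      then have cb: "c (Y \<inter> {..<m}, j) \<inter> {..<m} = Y \<inter> {..<m}" "j \<notin> F (c (Y \<inter> {..<m}, j))"
        using bspec[OF c b] by simp_all
      \<comment> \<open>Below \<open>m\<close> the two sets agree, and beyond it \<open>Y\<close> is
        inside every chosen counterexample.\<close>
      have "Y \<subseteq> c (Y \<inter> {..<m}, j)"
        using cb(1) YZ(4) b by blast
      then show False
        using cb(2) mono[OF YZ(1)] YZ(6) by blast
    qed
    then have "decides m (\<Inter>(c ` bad))"
      unfolding decides_def by blast
    with \<open>\<Inter>(c ` bad) \<in> D\<close> show ?thesis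
      by blast
  qed
  then obtain W where W: "\<And>m. W m \<in> D" and "\<And>m. decides m (W m)"
    by metis
  then have decide: "j \<in> F Z" if "Y \<in> D" "Z \<in> D" "j < m" "Y - {..<m} \<subseteq> W m"
    "Z \<inter> {..<m} = Y \<inter> {..<m}" "j \<in> F Y" for m Y Z j
    using that unfolding decides_def by blast
  obtain X where X: "X \<in> D" "\<And>j. \<exists>m>j. X - {..<m} \<subseteq> W m"
    using p_point_infinitely_often_subset[where W = W, OF assms(1) W] by blast
  show thesis
  proof (rule that[OF X(1)])
    fix Y assume Y: "Y \<in> D" "Y \<subseteq> X"
    have "\<exists>m. \<forall>Z\<in>D. Z \<inter> {..<m} = Y \<inter> {..<m} \<longrightarrow> j \<in> F Z" if "j \<in> F Y" for j
    proof -
      obtain m where "j < m" "X - {..<m} \<subseteq> W m"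
        using X(2) by blast
      moreover then have "Y - {..<m} \<subseteq> W m"
        using Y(2) by blast
      ultimately show ?thesis
        using decide Y(1) that by blast
    qed
    then show "F Y = {j. \<exists>m. \<forall>Z\<in>D. Z \<inter> {..<m} = Y \<inter> {..<m} \<longrightarrow> j \<in> F Z}"
      using Y(1) by blast
  qed
qed

section \<open>Codes for monotone maps by sets of natural numbers\<close>

definition approx_code :: "nat \<Rightarrow> nat set \<Rightarrow> nat \<Rightarrow> nat" where
  "approx_code m s j = prod_encode (m, prod_encode (set_encode s, j))"

lemma approx_code_eq_iff:
  "finite s \<Longrightarrow> finite t \<Longrightarrow>
    approx_code m s j = approx_code n t k \<longleftrightarrow> m = n \<and> s = t \<and> j = k"
  by (simp add: approx_code_def set_encode_eq)

definition coded_map :: "nat set \<Rightarrow> nat set \<Rightarrow> nat set" where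
  "coded_map T Y = {j. \<exists>m. approx_code m (Y \<inter> {..<m}) j \<in> T}"

text \<open>Codes have type \<open>nat set\<close>, so the stages of the tower can index all
  ultrafilters Tukey below a p-point \<open>D\<close>.\<close>

definition coded_family :: "nat set set \<Rightarrow> nat set \<Rightarrow> nat set set" where
  "coded_family D T = {Z. \<exists>Y\<in>D. coded_map T Y \<subseteq> Z}"

text \<open>By continuity below \<open>X\<close>, a monotone Tukey map can be read off from its
  finite approximations. Arguments not inside \<open>X\<close> do no harm: their coded value is
  \<open>UNIV\<close>, and a member \<open>Y\<close> of \<open>D\<close> can be shrunk to
  \<open>Y \<inter> X\<close>.\<close>

lemma Tukey_below_p_point_coded:
  assumes "p_point D" "is_ultrafilter E" "D \<ge>\<^sub>T E"
  shows "\<exists>T. E = coded_family D T"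
proof -
  have U: "is_ultrafilter D"
    using assms(1) by (simp add: p_point_def)
  obtain F where F: "F ` D \<subseteq> E" "\<And>X Y. X \<in> D \<Longrightarrow> X \<subseteq> Y \<Longrightarrow> F X \<subseteq> F Y"
      "\<And>Z. Z \<in> E \<Longrightarrow> \<exists>X\<in>D. F X \<subseteq> Z"
    using Tukey_ge_monotone[OF assms(3,2)] by blast
  obtain X where X: "X \<in> D" and cont: "\<And>Y. Y \<in> D \<Longrightarrow> Y \<subseteq> X \<Longrightarrow>
           F Y = {j. \<exists>m. \<forall>Z\<in>D. Z \<inter> {..<m} = Y \<inter> {..<m} \<longrightarrow> j \<in> F Z}"
    using p_point_monotone_continuous[where F = F, OF assms(1) F(2)] by blast
  \<comment> \<open>Approximations not contained in \<open>X\<close> are sent to everything, so that the code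
    also carries the restriction to subsets of \<open>X\<close>.\<close>
  define T where "T = {approx_code m s j | m s j.
    finite s \<and> (s \<subseteq> X \<longrightarrow> (\<forall>Z\<in>D. Z \<inter> {..<m} = s \<longrightarrow> j \<in> F Z))}"
  have T: "approx_code m s j \<in> T \<longleftrightarrow> (s \<subseteq> X \<longrightarrow> (\<forall>Z\<in>D. Z \<inter> {..<m} = s \<longrightarrow> j \<in> F Z))"
    if "finite s" for m s j
    unfolding T_def using that by (auto simp: approx_code_eq_iff)
  have inside: "coded_map T Y = F Y" if "Y \<in> D" "Y \<subseteq> X" for Y
  proof -
    have "Y \<inter> {..<m} \<subseteq> X" for m
      using that(2) by auto
    then show ?thesis
      unfolding coded_map_def cont[OF that] by (simp add: T)
  qed
  have outside: "coded_map T Y = UNIV" if YX: "\<not> Y \<subseteq> X" for Y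
  proof -
    obtain y where "y \<in> Y" "y \<notin> X"
      using YX by blast
    then have "\<not> Y \<inter> {..<Suc y} \<subseteq> X"
      by auto
    then have "approx_code (Suc y) (Y \<inter> {..<Suc y}) j \<in> T" for j
      by (simp add: T)
    then show ?thesis
      unfolding coded_map_def by blast
  qed
  have "coded_map T Y \<in> E" if "Y \<in> D" for Y
    using that inside outside F(1) ultrafilter_UNIV[OF assms(2)]
    by (cases "Y \<subseteq> X") auto
  then have "coded_family D T \<subseteq> E"
    using ultrafilter_mono[OF assms(2)] by (auto simp: coded_family_def)
  moreover have "Z \<in> coded_family D T" if Z: "Z \<in> E" for Z
  proof -
    obtain Y where Y: "Y \<in> D" "F Y \<subseteq> Z"
      using F(3) Z by blast
    have YX: "Y \<inter> X \<in> D"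
      using U Y(1) X by (rule ultrafilter_Int)
    then have "coded_map T (Y \<inter> X) \<subseteq> Z"
      using inside[OF YX] F(2)[OF YX, of Y] Y(2) by auto
    then show ?thesis
      using YX by (auto simp: coded_family_def)
  qed
  ultimately show ?thesis
    by blast
qed

section \<open>Large sets over a p-point\<close>

locale growing_fibres =
  fixes D :: "nat set set" and h :: "nat \<Rightarrow> nat"
  assumes p_point: "p_point D"
    and finite_fibre: "finite (h -` {n})"
    and card_fibre: "n \<le> card (h -` {n})"
begin

lemma ultrafilter: "is_ultrafilter D"
  using p_point by (simp add: p_point_def)

lemma cofinite_mem: "finite (- X) \<Longrightarrow> X \<in> D"
  using nonprincipal_not_finite[of D "- X"] p_point ultrafilter ultrafilter_Compl_iff
  by (auto simp: p_point_def)

text \<open>In the ultrapower of the naturals by \<open>D\<close>, the fibre size of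
  \<open>A\<close> exceeds every standard number.\<close>

definition large :: "nat set \<Rightarrow> bool" where
  "large A \<longleftrightarrow> (\<forall>k. {n. k \<le> card (A \<inter> h -` {n})} \<in> D)"

lemma large_UNIV: "large UNIV"
  unfolding large_def
proof
  fix k
  have "k \<le> card (UNIV \<inter> h -` {n})" if "k \<le> n" for n
    using order_trans[OF that card_fibre[of n]] by simp
  then have "- {n. k \<le> card (UNIV \<inter> h -` {n})} \<subseteq> {..<k}"
    by (auto simp: not_le[symmetric])
  then show "{n. k \<le> card (UNIV \<inter> h -` {n})} \<in> D"
    by (meson cofinite_mem finite_lessThan finite_subset)
qed

text \<open>A finite difference touches only finitely many fibres, and the other indices form a
  cofinite set, hence a member of \<open>D\<close>.\<close>

lemma large_almost_mono:
  assumes "large A" "finite (A - B)"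
  shows "large B"
  unfolding large_def
proof
  fix k
  have "- h ` (A - B) \<in> D"
    using assms(2) by (intro cofinite_mem) simp
  moreover have "{n. k \<le> card (A \<inter> h -` {n})} \<in> D"
    using assms(1) by (simp add: large_def)
  ultimately have "- h ` (A - B) \<inter> {n. k \<le> card (A \<inter> h -` {n})} \<in> D"
    using ultrafilter ultrafilter_Int by blast
  moreover have "card (A \<inter> h -` {n}) \<le> card (B \<inter> h -` {n})" if "n \<notin> h ` (A - B)" for n
    using that by (intro card_mono) (auto simp: finite_fibre)
  then have "- h ` (A - B) \<inter> {n. k \<le> card (A \<inter> h -` {n})} \<subseteq> {n. k \<le> card (B \<inter> h -` {n})}"
    using order_trans by blast
  ultimately show "{n. k \<le> card (B \<inter> h -` {n})} \<in> D"
    by (rule ultrafilter_mono[OF ultrafilter])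
qed

lemma large_not_finite: "large A \<Longrightarrow> infinite A"
proof
  assume "large A" "finite A"
  then have "large {}"
    using large_almost_mono[of A "{}"] by simp
  then have "{n. 1 \<le> card ({} \<inter> h -` {n})} \<in> D"
    unfolding large_def by blast
  then show False
    using ultrafilter by (simp add: is_ultrafilter_def)
qed

text \<open>Only fibres over \<open>X\<close> meet the preimage of \<open>X\<close>. This makes an
  ultrafilter of large sets project to \<open>D\<close>.\<close>

lemma large_vimage:
  assumes "large (h -` X)"
  shows "X \<in> D"
proof -
  have "{n. 1 \<le> card (h -` X \<inter> h -` {n})} \<in> D"
    using assms unfolding large_def by blast
  moreover have "n \<in> X" if "1 \<le> card (h -` X \<inter> h -` {n})" for n
  proof -
    have "h -` X \<inter> h -` {n} \<noteq> {}"
      using that by force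
    then show ?thesis by auto
  qed
  ultimately show ?thesis
    using ultrafilter_mono[OF ultrafilter] by blast
qed

text \<open>On every fibre one of the two pieces has at least half of the elements, and
  \<open>D\<close> settles which piece.\<close>

lemma large_decide:
  assumes "large A"
  shows "large (A \<inter> Y) \<or> large (A - Y)"
proof -
  have card: "card (A \<inter> h -` {n}) = card ((A \<inter> Y) \<inter> h -` {n}) + card ((A - Y) \<inter> h -` {n})" for n
  proof -
    have "A \<inter> h -` {n} = ((A \<inter> Y) \<inter> h -` {n}) \<union> ((A - Y) \<inter> h -` {n})"
      by blast
    moreover have "((A \<inter> Y) \<inter> h -` {n}) \<inter> ((A - Y) \<inter> h -` {n}) = {}"
      by blast
    ultimately show ?thesis
      by (metis card_Un_disjoint finite_Int finite_fibre)
  qed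
  define S where "S = {n. card (A \<inter> h -` {n}) \<le> 2 * card ((A \<inter> Y) \<inter> h -` {n})}"
  have half: "large B"
    if "R \<in> D" "\<And>n. n \<in> R \<Longrightarrow> card (A \<inter> h -` {n}) \<le> 2 * card (B \<inter> h -` {n})" for R B
    unfolding large_def
  proof
    fix k
    have "R \<inter> {n. 2 * k \<le> card (A \<inter> h -` {n})} \<in> D"
      using assms that(1) ultrafilter ultrafilter_Int unfolding large_def by blast
    then show "{n. k \<le> card (B \<inter> h -` {n})} \<in> D"
    proof (rule ultrafilter_mono[OF ultrafilter], intro subsetI CollectI)
      fix n assume "n \<in> R \<inter> {n. 2 * k \<le> card (A \<inter> h -` {n})}"
      then show "k \<le> card (B \<inter> h -` {n})"
        using that(2)[of n] by simp
    qed
  qed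
  show ?thesis
  proof (cases "S \<in> D")
    case True
    then have "large (A \<inter> Y)"
      by (rule half) (simp add: S_def)
    then show ?thesis ..
  next
    case False
    then have "- S \<in> D"
      using ultrafilter ultrafilter_Compl_iff by blast
    then have "large (A - Y)"
    proof (rule half)
      fix n assume "n \<in> - S"
      then have "2 * card ((A \<inter> Y) \<inter> h -` {n}) < card (A \<inter> h -` {n})"
        by (simp add: S_def)
      then show "card (A \<inter> h -` {n}) \<le> 2 * card ((A - Y) \<inter> h -` {n})"
        using card[of n] by linarith
    qed
    then show ?thesis ..
  qed
qed

text \<open>Each fibre of \<open>A\<close> is halved. Rounding down is harmless, as
  \<open>2 * k\<close> elements in a fibre still leave \<open>k\<close> in each half.\<close>

lemma large_split:
  assumes "large A"
  obtains B C where "B \<subseteq> A" "C \<subseteq> A" "B \<inter> C = {}" "large B" "large C"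
proof -
  have "\<exists>S \<subseteq> A \<inter> h -` {n}. card S = card (A \<inter> h -` {n}) div 2" for n
    by (metis obtain_subset_with_card_n div_le_dividend)
  then obtain S where S: "\<And>n. S n \<subseteq> A \<inter> h -` {n}"
    "\<And>n. card (S n) = card (A \<inter> h -` {n}) div 2"
    by metis
  define B where "B = (\<Union>n. S n)"
  have B_fibre: "B \<inter> h -` {n} = S n" for n
    using S(1) unfolding B_def by blast
  have C_fibre: "card ((A - B) \<inter> h -` {n}) = card (A \<inter> h -` {n}) - card (S n)" for n
  proof -
    have "(A - B) \<inter> h -` {n} = A \<inter> h -` {n} - S n"
      using B_fibre by blast
    moreover have "finite (S n)"
      using S(1) finite_fibre by (meson finite_Int finite_subset)
    ultimately show ?thesis
      using S(1) by (simp add: card_Diff_subset)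
  qed
  have large_half: "large C"
    if "\<And>n. card (A \<inter> h -` {n}) div 2 \<le> card (C \<inter> h -` {n})" for C
    unfolding large_def
  proof
    fix k
    have "{n. 2 * k \<le> card (A \<inter> h -` {n})} \<in> D"
      using assms by (simp add: large_def)
    then show "{n. k \<le> card (C \<inter> h -` {n})} \<in> D"
    proof (rule ultrafilter_mono[OF ultrafilter])
      have "k \<le> card (C \<inter> h -` {n})" if "2 * k \<le> card (A \<inter> h -` {n})" for n
        using that \<open>card (A \<inter> h -` {n}) div 2 \<le> card (C \<inter> h -` {n})\<close> by linarith
      then show "{n. 2 * k \<le> card (A \<inter> h -` {n})} \<subseteq> {n. k \<le> card (C \<inter> h -` {n})}"
        by blast
    qed
  qed
  show thesis
  proof (rule that)
    show "B \<subseteq> A" using S(1) by (auto simp: B_def)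
    show "large B" by (rule large_half) (simp add: B_fibre S(2))
    show "large (A - B)" by (rule large_half) (simp add: C_fibre S(2))
  qed auto
qed

section \<open>Pseudo-intersections of large sets\<close>

text \<open>Over \<open>n\<close> in \<open>X\<close> the set \<open>B\<close> copies
  \<open>A (K n)\<close>, with \<open>K n\<close> unbounded along \<open>D\<close>. Since
  \<open>X\<close> is a pseudo-intersection of the index sets \<open>P k\<close>, the set
  \<open>B - A k\<close> is confined to finitely many finite fibres.\<close>

lemma large_decseq_pseudo_intersection:
  assumes "decseq A" "\<And>k. large (A k)"
  obtains B where "large B" "\<And>k. finite (B - A k)"
proof -
  define P where "P k = {n. k \<le> card (A k \<inter> h -` {n})}" for k
  have P: "P k \<in> D" for k
    using assms(2) by (simp add: large_def P_def)
  then have "range P \<subseteq> D \<and> countable (range P)"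
    by auto
  then obtain X where X: "X \<in> D" "\<And>k. finite (X - P k)"
    using p_point unfolding p_point_def by (metis rangeI)
  \<comment> \<open>The bound \<open>k \<le> n\<close> makes the maximum exist, and
    \<open>k = 0\<close> always qualifies because \<open>P 0\<close> is everything.\<close>
  define K where "K n = Max {k. k \<le> n \<and> n \<in> P k}" for n
  have K_in: "n \<in> P (K n)" for n
  proof -
    have "0 \<in> {k. k \<le> n \<and> n \<in> P k}"
      by (simp add: P_def)
    then have "K n \<in> {k. k \<le> n \<and> n \<in> P k}"
      unfolding K_def by (intro Max_in) auto
    then show ?thesis by simp
  qed
  have K_ge: "k \<le> K n" if "k \<le> n" "n \<in> P k" for k n
    unfolding K_def using that by (intro Max_ge) auto
  define B where "B = {x. h x \<in> X \<and> x \<in> A (K (h x))}"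
  show thesis
  proof (rule that)
    show "large B"
      unfolding large_def
    proof
      fix k
      have "{k..} \<in> D"
        by (rule cofinite_mem) (simp add: finite_subset[of _ "{..<k}"] subset_iff)
      then have "X \<inter> (P k \<inter> {k..}) \<in> D"
        using X(1) P ultrafilter ultrafilter_Int by blast
      then show "{n. k \<le> card (B \<inter> h -` {n})} \<in> D"
      proof (rule ultrafilter_mono[OF ultrafilter], intro subsetI CollectI)
        fix n assume n: "n \<in> X \<inter> (P k \<inter> {k..})"
        then have "B \<inter> h -` {n} = A (K n) \<inter> h -` {n}"
          by (auto simp: B_def)
        then have "K n \<le> card (B \<inter> h -` {n})"
          using K_in[of n] by (simp add: P_def)
        then show "k \<le> card (B \<inter> h -` {n})"
          using K_ge[of k n] n by simp
      qed
    qed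
    show "finite (B - A k)" for k
    proof (rule finite_subset)
      show "B - A k \<subseteq> (\<Union>n\<in>(X - P k) \<union> {..<k}. h -` {n})"
      proof
        fix x assume x: "x \<in> B - A k"
        have "\<not> k \<le> K (h x)"
          using x decseqD[OF assms(1), of k "K (h x)"] by (auto simp: B_def)
        then show "x \<in> (\<Union>n\<in>(X - P k) \<union> {..<k}. h -` {n})"
          using x K_ge[of k "h x"] by (cases "k \<le> h x") (auto simp: B_def)
      qed
      show "finite (\<Union>n\<in>(X - P k) \<union> {..<k}. h -` {n})"
        using X(2) finite_fibre by blast
    qed
  qed
qed

lemma large_countable_pseudo_intersection:
  assumes "countable \<A>" "\<And>\<F>. finite \<F> \<Longrightarrow> \<F> \<subseteq> \<A> \<Longrightarrow> large (\<Inter>\<F>)"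
  obtains B where "large B" "\<And>A. A \<in> \<A> \<Longrightarrow> finite (B - A)"
proof (cases "\<A> = {}")
  case True
  then show thesis
    using that large_UNIV by blast
next
  case False
  define A where "A k = \<Inter>(from_nat_into \<A> ` {..k})" for k
  have "decseq A"
    unfolding decseq_def A_def by (auto simp: Inter_anti_mono)
  moreover have "large (A k)" for k
    unfolding A_def using from_nat_into[OF False] by (intro assms(2)) auto
  ultimately obtain B where B: "large B" "\<And>k. finite (B - A k)"
    using large_decseq_pseudo_intersection by blast
  have "finite (B - Y)" if Y: "Y \<in> \<A>" for Y
  proof -
    obtain k where "from_nat_into \<A> k = Y"
      using from_nat_into_surj[OF assms(1) Y] by blast
    then have "A k \<subseteq> Y"
      by (auto simp: A_def)
    then show ?thesis
      using B(2)[of k] by (meson Diff_mono finite_subset order_refl)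
  qed
  then show thesis
    using that B(1) by blast
qed

text \<open>One stage of the tower. After a pseudo-intersection is taken and \<open>Y\<close>
  decided, the set is split into two disjoint large halves; an ultrafilter \<open>U\<close> contains
  at most one of them, so one can be kept that is outside \<open>U\<close>.\<close>

lemma large_next:
  assumes "countable \<A>" "\<And>\<F>. finite \<F> \<Longrightarrow> \<F> \<subseteq> \<A> \<Longrightarrow> large (\<Inter>\<F>)"
  shows "\<exists>B. large B \<and> (\<forall>A\<in>\<A>. finite (B - A)) \<and> (B \<subseteq> Y \<or> B \<inter> Y = {}) \<and>
    (is_ultrafilter U \<longrightarrow> B \<notin> U)"
proof -
  obtain B where B: "large B" "\<And>A. A \<in> \<A> \<Longrightarrow> finite (B - A)"
    using large_countable_pseudo_intersection[OF assms] by blast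
  obtain C where C: "large C" "C \<subseteq> B" "C \<subseteq> Y \<or> C \<inter> Y = {}"
    using large_decide[OF B(1), of Y] by blast
  obtain C1 C2 where split: "C1 \<subseteq> C" "C2 \<subseteq> C" "C1 \<inter> C2 = {}" "large C1" "large C2"
    using large_split[OF C(1)] by blast
  have "\<exists>C'. C' \<subseteq> C \<and> large C' \<and> (is_ultrafilter U \<longrightarrow> C' \<notin> U)"
    using split ultrafilter_disjoint[of U C1 C2] by blast
  then obtain C' where C': "C' \<subseteq> C" "large C'" "is_ultrafilter U \<longrightarrow> C' \<notin> U"
    by blast
  moreover have "finite (C' - A)" if "A \<in> \<A>" for A
    using B(2)[OF that] by (rule finite_subset[rotated]) (use C' C in blast)
  moreover have "C' \<subseteq> Y \<or> C' \<inter> Y = {}"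
    using C' C by blast
  ultimately show ?thesis
    by blast
qed

section \<open>The tower of large sets\<close>

text \<open>The stages of the tower are the sets of naturals themselves, well-ordered by their
  cardinal. A single \<open>a\<close> serves as the stage, as the set decided there, and as the
  index of the family avoided there.\<close>

lemma p_point_avoiding:
  fixes U :: "nat set \<Rightarrow> nat set set"
  assumes CH
  obtains E where "p_point E" "E \<ge>\<^sub>R\<^sub>K D" "\<And>a. is_ultrafilter (U a) \<Longrightarrow> E \<noteq> U a"
proof -
  define r where "r = |UNIV :: nat set set|"
  have wo: "Well_order r" and Field: "Field r = UNIV"
    unfolding r_def by (rule card_of_Well_order, rule Field_card_of)
  have co: "Card_order r"
    unfolding r_def by (rule card_of_Card_order)
  \<comment> \<open>Under CH a proper initial segment of \<open>r\<close> has size below the first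
    uncountable cardinal.\<close>
  have countable_below: "countable {b. (b, a) \<in> r - Id}" for a
  proof -
    have "|underS r a| <o r"
      using card_of_underS[OF co, of a] Field by simp
    then have "|underS r a| <o cardSuc natLeq"
      using assms unfolding CH_def r_def by (rule ordLess_ordIso_trans)
    then have "|underS r a| \<le>o natLeq"
      using cardSuc_ordLeq_ordLess[OF natLeq_Card_order card_of_Card_order] by blast
    moreover have "underS r a = {b. (b, a) \<in> r - Id}"
      by (auto simp: underS_def)
    ultimately show ?thesis
      by (simp add: countable_card_le_natLeq)
  qed
  have wf: "wf (r - Id)" and total: "Total r" and trans: "trans r" and refl: "(a, a) \<in> r" for a
    using wo Field by (simp_all add: well_order_on_def linear_order_on_def
        partial_order_on_def preorder_on_def refl_on_def)
  define Q where "Q f a B \<longleftrightarrow> large B \<and> (\<forall>b. (b, a) \<in> r - Id \<longrightarrow> finite (B - f b)) \<and>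
    (B \<subseteq> a \<or> B \<inter> a = {}) \<and> (is_ultrafilter (U a) \<longrightarrow> B \<notin> U a)"
    for f :: "nat set \<Rightarrow> nat set" and a B
  have "\<exists>f. \<forall>a. Q f a (f a)"
  proof (rule dependent_wf_choice[OF wf])
    show "Q f a B = Q g a B" if "\<And>b. (b, a) \<in> r - Id \<Longrightarrow> f b = g b" for f g a B
      using that by (auto simp: Q_def)
    fix a f assume IH: "\<And>b. (b, a) \<in> r - Id \<Longrightarrow> Q f b (f b)"
    define I where "I = {b. (b, a) \<in> r - Id}"
    \<comment> \<open>The set chosen at the latest stage in \<open>J\<close> is almost contained in
      all the others.\<close>
    have "large (\<Inter>(f ` J))" if "finite J" "J \<subseteq> I" for J
    proof (cases "J = {}")
      case True
      then show ?thesis by (simp add: large_UNIV)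
    next
      case False
      have "\<exists>m\<in>J. \<forall>b\<in>J. (b, m) \<in> r"
        using that(1) False
      proof (induction rule: finite_ne_induct)
        case (singleton x)
        then show ?case
          using refl by simp
      next
        case (insert x J)
        then obtain m where m: "m \<in> J" "\<forall>b\<in>J. (b, m) \<in> r" by blast
        show ?case
        proof (cases "(x, m) \<in> r")
          case True
          then show ?thesis using m by blast
        next
          case False
          then have "(m, x) \<in> r"
            using total Field refl by (metis UNIV_I total_on_def)
          then show ?thesis using m trans refl by (metis insert_iff transD)
        qed
      qed
      then obtain m where m: "m \<in> J" "\<forall>b\<in>J. (b, m) \<in> r" by blast
      have Qm: "Q f m (f m)"
        using m(1) that(2) by (intro IH) (auto simp: I_def)
      have "finite (\<Union>b\<in>J. f m - f b)"
      proof (intro finite_UN_I that(1))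
        show "finite (f m - f b)" if "b \<in> J" for b
          using Qm m that by (cases "b = m") (auto simp: Q_def)
      qed
      moreover have "f m - \<Inter>(f ` J) = (\<Union>b\<in>J. f m - f b)"
        by blast
      ultimately have "finite (f m - \<Inter>(f ` J))"
        by (simp only:)
      moreover have "large (f m)"
        using Qm by (simp add: Q_def)
      ultimately show ?thesis
        by (rule large_almost_mono[rotated])
    qed
    then have inter: "large (\<Inter>\<F>)" if "finite \<F>" "\<F> \<subseteq> f ` I" for \<F>
      using finite_subset_image[OF that] by blast
    have "countable (f ` I)"
      using countable_below[of a] by (simp add: I_def)
    from large_next[OF this inter, of a "U a"] obtain B where
      "large B \<and> (\<forall>A\<in>f ` I. finite (B - A)) \<and> (B \<subseteq> a \<or> B \<inter> a = {}) \<and>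
       (is_ultrafilter (U a) \<longrightarrow> B \<notin> U a)" ..
    then have "Q f a B"
      by (simp add: Q_def I_def)
    then show "\<exists>B. Q f a B" ..
  qed
  then obtain f where "\<forall>a. Q f a (f a)" ..
  then have large: "large (f a)"
    and tower: "\<And>b. (b, a) \<in> r - Id \<Longrightarrow> finite (f a - f b)"
    and decided: "f a \<subseteq> a \<or> f a \<inter> a = {}"
    and avoids: "is_ultrafilter (U a) \<Longrightarrow> f a \<notin> U a" for a
    unfolding Q_def by blast+
  define E where "E = {Y. \<exists>a. finite (f a - Y)}"
  have E_large: "large Y" if "Y \<in> E" for Y
    using that large large_almost_mono by (auto simp: E_def)
  \<comment> \<open>This gives the p-point property and, for two-element families, closure of
    \<open>E\<close> under intersection.\<close>
  have bound: "\<exists>X\<in>E. \<forall>Y\<in>\<C>. finite (X - Y)" if \<C>: "\<C> \<subseteq> E" "countable \<C>" for \<C>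
  proof -
    have "\<forall>Y\<in>\<C>. \<exists>a. finite (f a - Y)"
      using \<C>(1) by (auto simp: E_def)
    then obtain i where i: "\<forall>Y\<in>\<C>. finite (f (i Y) - Y)"
      unfolding bchoice_iff ..
    have "{b. (b, a) \<in> r} \<subseteq> insert a {b. (b, a) \<in> r - Id}" for a
      by auto
    then have "countable {b. (b, a) \<in> r}" for a
      by (rule countable_subset) (intro countable_insert countable_below)
    then have "countable (\<Union>Y\<in>\<C>. {b. (b, i Y) \<in> r})"
      using \<C>(2) by blast
    moreover have "uncountable (UNIV :: nat set set)"
      unfolding uncountable_def using Cantors_theorem[of "UNIV :: nat set"] by simp
    \<comment> \<open>Countably many countable initial segments do not exhaust an uncountable order,
      so some stage \<open>c\<close> lies beyond every \<open>i Y\<close>.\<close>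
    ultimately have "(\<Union>Y\<in>\<C>. {b. (b, i Y) \<in> r}) \<noteq> UNIV"
      by metis
    then obtain c where c: "\<And>Y. Y \<in> \<C> \<Longrightarrow> (c, i Y) \<notin> r"
      by blast
    have "finite (f c - Y)" if "Y \<in> \<C>" for Y
    proof -
      have "i Y \<noteq> c"
        using c[OF that] refl by auto
      then have "(i Y, c) \<in> r - Id"
        using total Field c[OF that] by (auto simp: total_on_def)
      then have "finite ((f c - f (i Y)) \<union> (f (i Y) - Y))"
        using tower i that by simp
      then show ?thesis
        by (rule finite_subset[rotated]) blast
    qed
    moreover have "f c \<in> E"
      unfolding E_def by (auto intro: exI[of _ c])
    ultimately show ?thesis by blast
  qed
  have E_mono: "Y \<in> E" if X: "finite (X - Y)" "X \<in> E" for X Y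
  proof -
    obtain a where "finite (f a - X)"
      using X(2) by (auto simp: E_def)
    then have "finite ((f a - X) \<union> (X - Y))"
      using X(1) by simp
    then have "finite (f a - Y)"
      by (rule finite_subset[rotated]) blast
    then show ?thesis by (auto simp: E_def)
  qed
  have U_E: "is_ultrafilter E"
    unfolding is_ultrafilter_def
  proof (intro conjI ballI allI impI)
    show "UNIV \<in> E" by (simp add: E_def)
    show "{} \<notin> E" using E_large large_not_finite by blast
    show "X \<inter> Y \<in> E" if XY: "X \<in> E" "Y \<in> E" for X Y
    proof -
      obtain Z where "Z \<in> E" "finite (Z - X)" "finite (Z - Y)"
        using bound[of "{X, Y}"] XY by auto
      then show ?thesis
        using E_mono[of Z "X \<inter> Y"] by (simp add: Diff_Int)
    qed
    show "Y \<in> E" if "X \<in> E" "X \<subseteq> Y" for X Y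
      using E_mono that by (metis Diff_eq_empty_iff finite.emptyI)
    show "X \<in> E \<or> - X \<in> E" for X
    proof -
      \<comment> \<open>Stage \<open>X\<close> has decided the set \<open>X\<close>.\<close>
      have "f X - X = {} \<or> f X - (- X) = {}"
        using decided[of X] by blast
      then show ?thesis
        unfolding E_def by (elim disjE) (metis (mono_tags) finite.emptyI mem_Collect_eq)+
    qed
  qed
  have "nonprincipal E"
    unfolding nonprincipal_def
  proof
    assume "\<exists>a. E = {X. a \<in> X}"
    then obtain a where "{a} \<in> E" by auto
    then show False using E_large large_not_finite by blast
  qed
  then have pE: "p_point E"
    using U_E bound by (simp add: p_point_def)
  have "E \<ge>\<^sub>R\<^sub>K D"
  proof -
    \<comment> \<open>Largeness gives one inclusion; applied to complements it gives the
      other.\<close>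
    have "X \<in> D \<longleftrightarrow> h -` X \<in> E" for X
    proof
      show "h -` X \<in> E \<Longrightarrow> X \<in> D"
        using E_large large_vimage by blast
      show "h -` X \<in> E" if "X \<in> D"
      proof (rule ccontr)
        assume "h -` X \<notin> E"
        then have "h -` (- X) \<in> E"
          using ultrafilter_Compl_iff[OF U_E] by (simp add: vimage_Compl)
        then have "- X \<in> D"
          using E_large large_vimage by blast
        then show False
          using that ultrafilter ultrafilter_Compl_iff by blast
      qed
    qed
    then show ?thesis
      unfolding RK_ge_def by blast
  qed
  moreover have "E \<noteq> U a" if "is_ultrafilter (U a)" for a
  proof -
    have "f a \<in> E"
      unfolding E_def by (auto intro: exI[of _ a])
    then show ?thesis
      using avoids[OF that] by blast
  qed
  ultimately show thesis
    using that pE by blast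
qed

end

section \<open>Existence of the projection, and the conclusion\<close>

text \<open>The code of a pair is sent to the sum of its entries: the fibre over \<open>n\<close> is
  an antidiagonal with \<open>n + 1\<close> elements.\<close>

lemma growing_fibres_exist: "\<exists>h :: nat \<Rightarrow> nat. \<forall>n. finite (h -` {n}) \<and> n \<le> card (h -` {n})"
proof (intro exI allI)
  fix n
  define g where "g a = prod_encode (a, n - a)" for a
  have "(\<lambda>x. case prod_decode x of (a, b) \<Rightarrow> a + b) -` {n} = g ` {..n}"
  proof (intro subset_antisym subsetI)
    fix x assume "x \<in> (\<lambda>x. case prod_decode x of (a, b) \<Rightarrow> a + b) -` {n}"
    then obtain a b where "prod_decode x = (a, b)" "a + b = n"
      by (auto split: prod.splits)
    then have "x = g a" "a \<le> n"
      by (auto simp: g_def) (metis prod_decode_inverse)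
    then show "x \<in> g ` {..n}" by blast
  qed (auto simp: g_def)
  moreover have "inj_on g {..n}"
    by (rule inj_onI) (simp add: g_def)
  ultimately show "finite ((\<lambda>x. case prod_decode x of (a, b) \<Rightarrow> a + b) -` {n}) \<and>
      n \<le> card ((\<lambda>x. case prod_decode x of (a, b) \<Rightarrow> a + b) -` {n})"
    by (simp add: card_image)
qed

theorem theorem52:
  fixes D :: "nat set set"
  assumes "CH" and "p_point D"
  shows "\<exists>E. p_point E \<and> E >\<^sub>R\<^sub>K D \<and> E >\<^sub>T D"
proof -
  obtain h :: "nat \<Rightarrow> nat" where "\<And>n. finite (h -` {n})" "\<And>n. n \<le> card (h -` {n})"
    using growing_fibres_exist by blast
  then interpret growing_fibres D h
    using assms(2) by unfold_locales
  \<comment> \<open>The families to be avoided are \<open>coded_family D T\<close> for all codes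
    \<open>T\<close>.\<close>
  obtain E where E: "p_point E" "E \<ge>\<^sub>R\<^sub>K D"
    "\<And>T. is_ultrafilter (coded_family D T) \<Longrightarrow> E \<noteq> coded_family D T"
    using p_point_avoiding[OF assms(1)] by blast
  have U_E: "is_ultrafilter E"
    using E(1) by (simp add: p_point_def)
  have "\<not> D \<ge>\<^sub>T E"
    using Tukey_below_p_point_coded[OF assms(2) U_E] E(3) U_E by blast
  \<comment> \<open>A Rudin-Keisler reduction yields a Tukey reduction, so failure of the latter
    makes both orders strict.\<close>
  moreover then have "\<not> D \<ge>\<^sub>R\<^sub>K E"
    using RK_ge_imp_Tukey_ge[OF ultrafilter] by blast
  moreover have "E \<ge>\<^sub>T D"
    using RK_ge_imp_Tukey_ge[OF U_E E(2)] .
  ultimately show ?thesis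
    using E(1,2) by (auto simp: RK_gt_def Tukey_gt_def)
qed

end
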